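(* Let $\|\cdot\|$ be a norm on $\mathbb{R}^d$. Let $\mathcal{C}\subset\mathbb{R}^d$ be a compact convex set that is $(\alpha,q)$-uniformly convex with respect to $\|\cdot\|$, with $\alpha>0$ and $q\ge2$. Let $f$ be an $L$-smooth convex function satisfying a $(\mu,\theta)$-Hölderian error bound with $\mu>0$ and $\theta\in(0,1/2]$, i.e., with $x^*=\arg\min_{x\in\mathcal{C}}f(x)$, $$\|x-x^*\|\le\mu\,(f(x)-f(x^* ))^{\theta}\quad\text{for all }x\in\mathcal{C}.$$ Let $(x_t)$ be the iterates of the Frank-Wolfe algorithm with short step or with exact line search, started at $x_0\in\mathcal{C}$, and $h_0=f(x_0)-f(x^* )$. Then for all $T\ge0$ $$f(x_T)-f(x^* )\le\frac{M}{(T+k)^{1/(1-2\theta/q)}},$$ where $\eta=1-2\theta/q$, $C=(\alpha/\mu)^{2/q}/L$, $k=(2-2^\eta)/(2^\eta-1)$ and $$M=\max\Big\{h_0k^{1/\eta},\ \frac{2}{\big((\eta-(1-\eta)(2^\eta-1))\,C\big)^{1/\eta}}\Big\}.$$ In particular, for $q=2$ and $\theta=1/2$, $f(x_T)-f(x^* )=\mathcal{O}(1/T^2)$.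
   Context: Dual norm: $\|d\|_*=\max_{\|x\|\le1}\langle x;d\rangle$. Uniform convexity of a set: a closed set $\mathcal{C}\subset\mathbb{R}^d$ is $(\alpha,q)$-uniformly convex with respect to $\|\cdot\|$ if for all $x,y\in\mathcal{C}$, all $\eta\in[0,1]$ and all $z\in\mathbb{R}^d$ with $\|z\|=1$, $\eta x+(1-\eta)y+\eta(1-\eta)\alpha\|x-y\|^q z\in\mathcal{C}$. $L$-smooth ($L>0$): $f$ is differentiable and $\|\nabla f(x)-\nabla f(y)\|_*\le L\|x-y\|$ for all $x,y$ (in $\mathcal{C}$). Frank-Wolfe algorithm: starting from $x_0\in\mathcal{C}$, for $t\ge0$ pick $v_t\in\arg\max_{v\in\mathcal{C}}\langle-\nabla f(x_t);v-x_t\rangle$, choose $\gamma_t\in[0,1]$, and set $x_{t+1}=(1-\gamma_t)x_t+\gamma_tv_t$. Short step: $\gamma_t\in\arg\min_{\gamma\in[0,1]}\gamma\langle v_t-x_t;\nabla f(x_t)\rangle+\frac{\gamma^2}{2}L\|v_t-x_t\|^2$. Exact line search: $\gamma_t\in\arg\min_{\gamma\in[0,1]}f((1-\gamma)x_t+\gamma v_t)$. *)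

theory Defs
  imports "HOL-Analysis.Analysis" "HOL-Library.Landau_Symbols"
begin

text \<open>
  The norm is an arbitrary norm \<open>N\<close> on \<open>real ^ 'n\<close>, in general different from the Euclidean
  norm of the type class; the pairing is the standard inner product.
\<close>

definition is_norm :: "(real ^ 'n \<Rightarrow> real) \<Rightarrow> bool" where
  "is_norm N \<longleftrightarrow>
     (\<forall>x. 0 \<le> N x) \<and>
     (\<forall>x. N x = 0 \<longleftrightarrow> x = 0) \<and>
     (\<forall>a x. N (a *\<^sub>R x) = \<bar>a\<bar> * N x) \<and>
     (\<forall>x y. N (x + y) \<le> N x + N y)"

text \<open>For a norm \<open>N\<close> the supremum is finite and attained, since the unit ball is compact.\<close>

definition dual_norm :: "(real ^ 'n \<Rightarrow> real) \<Rightarrow> real ^ 'n \<Rightarrow> real" where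
  "dual_norm N d = (SUP x\<in>{x. N x \<le> 1}. x \<bullet> d)"

definition uniformly_convex_set ::
    "(real ^ 'n \<Rightarrow> real) \<Rightarrow> real \<Rightarrow> real \<Rightarrow> (real ^ 'n) set \<Rightarrow> bool" where
  "uniformly_convex_set N \<alpha> q C \<longleftrightarrow>
     closed C \<and>
     (\<forall>x\<in>C. \<forall>y\<in>C. \<forall>\<eta>\<in>{0..1}. \<forall>z. N z = 1 \<longrightarrow>
        \<eta> *\<^sub>R x + (1 - \<eta>) *\<^sub>R y + (\<eta> * (1 - \<eta>) * \<alpha> * N (x - y) powr q) *\<^sub>R z \<in> C)"

text \<open>Meaningful only where \<open>f\<close> is differentiable, where the gradient is unique.\<close>

definition gradient :: "(real ^ 'n \<Rightarrow> real) \<Rightarrow> real ^ 'n \<Rightarrow> real ^ 'n" where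
  "gradient f x = (THE D. GDERIV f x :> D)"

definition L_smooth_on ::
    "(real ^ 'n \<Rightarrow> real) \<Rightarrow> real \<Rightarrow> (real ^ 'n) set \<Rightarrow> (real ^ 'n \<Rightarrow> real) \<Rightarrow> bool" where
  "L_smooth_on N L C f \<longleftrightarrow>
     L > 0 \<and>
     (\<forall>x\<in>C. f differentiable at x) \<and>
     (\<forall>x\<in>C. \<forall>y\<in>C. dual_norm N (gradient f x - gradient f y) \<le> L * N (x - y))"

definition hoelder_error_bound ::
    "(real ^ 'n \<Rightarrow> real) \<Rightarrow> real \<Rightarrow> real \<Rightarrow> (real ^ 'n) set \<Rightarrow> (real ^ 'n \<Rightarrow> real) \<Rightarrow>
     real ^ 'n \<Rightarrow> bool" where
  "hoelder_error_bound N \<mu> \<theta> C f xs \<longleftrightarrow>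
     (\<forall>x\<in>C. N (x - xs) \<le> \<mu> * (f x - f xs) powr \<theta>)"

definition frank_wolfe ::
    "(real ^ 'n) set \<Rightarrow> (real ^ 'n \<Rightarrow> real) \<Rightarrow> (nat \<Rightarrow> real ^ 'n) \<Rightarrow> (nat \<Rightarrow> real ^ 'n) \<Rightarrow>
     (nat \<Rightarrow> real) \<Rightarrow> bool" where
  "frank_wolfe C f x v \<gamma> \<longleftrightarrow>
     x 0 \<in> C \<and>
     (\<forall>t. is_arg_max (\<lambda>w. (- gradient f (x t)) \<bullet> (w - x t)) (\<lambda>w. w \<in> C) (v t) \<and>
          \<gamma> t \<in> {0..1} \<and>
          x (Suc t) = (1 - \<gamma> t) *\<^sub>R x t + \<gamma> t *\<^sub>R v t)"

definition short_step ::
    "(real ^ 'n \<Rightarrow> real) \<Rightarrow> real \<Rightarrow> (real ^ 'n \<Rightarrow> real) \<Rightarrow> (nat \<Rightarrow> real ^ 'n) \<Rightarrow>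
     (nat \<Rightarrow> real ^ 'n) \<Rightarrow> (nat \<Rightarrow> real) \<Rightarrow> bool" where
  "short_step N L f x v \<gamma> \<longleftrightarrow>
     (\<forall>t. is_arg_min
            (\<lambda>g. g * ((v t - x t) \<bullet> gradient f (x t)) + g\<^sup>2 / 2 * L * (N (v t - x t))\<^sup>2)
            (\<lambda>g. g \<in> {0..1}) (\<gamma> t))"

definition exact_line_search ::
    "(real ^ 'n \<Rightarrow> real) \<Rightarrow> (nat \<Rightarrow> real ^ 'n) \<Rightarrow> (nat \<Rightarrow> real ^ 'n) \<Rightarrow> (nat \<Rightarrow> real) \<Rightarrow> bool" where
  "exact_line_search f x v \<gamma> \<longleftrightarrow>
     (\<forall>t. is_arg_min (\<lambda>g. f ((1 - g) *\<^sub>R x t + g *\<^sub>R v t)) (\<lambda>g. g \<in> {0..1}) (\<gamma> t))"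

end

theory Submission
  imports Defs
begin

text \<open>
  Let \<open>h\<close> be the primal gap at an iterate, \<open>g\<close> the Frank-Wolfe gap, \<open>n\<close> the length of \<open>v - x\<close> and
  \<open>H = h\<^sup>\<eta>\<close>. Uniform convexity of the set, tested in the direction \<open>xs - x\<close>, combined with the
  error bound gives \<open>Cc H L n\<^sup>2 \<le> g\<close>. Every step decreases the gap at least as much as any
  \<open>\<gamma> \<in> [0,1]\<close> does in the quadratic upper model, so either the full step at least halves \<open>h\<close>, or
  \<open>h' \<le> h (1 - Cc H / 2)\<close>. Both preserve the invariant \<open>H (t + k) \<le> M\<^sup>\<eta>\<close>, except that halving
  alone does not suffice at \<open>t = 0\<close>, where \<open>(2\<^sup>\<eta> - 1) k < 1\<close>. There a full step that
  shrinks \<open>H\<close> by less than the factor \<open>2 - 2\<^sup>\<eta>\<close> forces \<open>L n\<^sup>2\<close> to be comparable with \<open>h\<close>,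
  and the curvature inequality then bounds \<open>H\<close> absolutely.
\<close>

section \<open>Norms and dual norms\<close>

lemma is_normD:
  assumes "is_norm N"
  shows "0 \<le> N x" "N x = 0 \<longleftrightarrow> x = 0" "N (a *\<^sub>R x) = \<bar>a\<bar> * N x" "N (x + y) \<le> N x + N y"
  using assms by (auto simp: is_norm_def)

lemma is_norm_minus_commute:
  assumes "is_norm N"
  shows "N (x - y) = N (y - x)"
  using is_normD(3)[OF assms, of "-1" "x - y"] by simp

text \<open>A norm is convex, hence continuous on the whole space, so it attains its minimum on the
  Euclidean unit sphere. This minimum is positive, and homogeneity carries it to all
  vectors.\<close>

lemma is_norm_bounds_norm:
  fixes N :: "real ^ 'n \<Rightarrow> real"
  assumes "is_norm N"
  obtains c where "c > 0" "\<And>x. c * norm x \<le> N x"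
proof -
  have "convex_on UNIV N"
  proof (rule convex_onI)
    fix t :: real and x y :: "real ^ 'n" assume t: "0 < t" "t < 1"
    show "N ((1 - t) *\<^sub>R x + t *\<^sub>R y) \<le> (1 - t) * N x + t * N y"
      using is_normD(4)[OF assms, of "(1 - t) *\<^sub>R x" "t *\<^sub>R y"] t
      by (simp add: is_normD(3)[OF assms])
  qed auto
  then have "continuous_on UNIV N"
    using convex_on_continuous by blast
  then have cont: "continuous_on (sphere 0 1) N"
    using continuous_on_subset by blast
  have ne: "sphere (0 :: real ^ 'n) 1 \<noteq> {}"
    by simp
  obtain u :: "real ^ 'n" where u: "u \<in> sphere 0 1" "\<And>y. y \<in> sphere 0 1 \<Longrightarrow> N u \<le> N y"
    using continuous_attains_inf[OF compact_sphere ne cont] by blast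
  show thesis
  proof (rule that[of "N u"])
    show "N u > 0"
      using u(1) is_normD(1,2)[OF assms, of u] by (cases "u = 0") auto
    show "N u * norm x \<le> N x" for x
    proof (cases "x = 0")
      case False
      then have "N u \<le> N ((1 / norm x) *\<^sub>R x)"
        by (intro u(2)) simp
      then show ?thesis
        using False by (simp add: is_normD(3)[OF assms] field_simps)
    qed (simp add: is_normD[OF assms])
  qed
qed

lemma inner_le_dual_norm:
  fixes N :: "real ^ 'n \<Rightarrow> real"
  assumes "is_norm N"
  shows "x \<bullet> d \<le> N x * dual_norm N d"
proof (cases "x = 0")
  case False
  obtain c where c: "c > 0" "\<And>x. c * norm x \<le> N x"
    using is_norm_bounds_norm[OF assms] by blast
  \<comment> \<open>The supremum in \<open>dual_norm\<close> is an upper bound only once the set of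
    values is known to be bounded; the comparison with the Euclidean norm supplies this through
    Cauchy-Schwarz.\<close>
  have "bdd_above ((\<lambda>x. x \<bullet> d) ` {x. N x \<le> 1})"
  proof (rule bdd_aboveI2)
    fix x assume "x \<in> {x. N x \<le> 1}"
    then have "norm x \<le> 1 / c"
      using c(1) c(2)[of x] by (simp add: field_simps)
    then have "norm x * norm d \<le> 1 / c * norm d"
      by (rule mult_right_mono) simp
    then show "x \<bullet> d \<le> 1 / c * norm d"
      using norm_cauchy_schwarz[of x d] by linarith
  qed
  moreover have pos: "N x > 0"
    using False is_normD(1,2)[OF assms, of x] by simp
  ultimately have "((1 / N x) *\<^sub>R x) \<bullet> d \<le> dual_norm N d"
    unfolding dual_norm_def
    by (intro cSUP_upper) (auto simp: is_normD(3)[OF assms])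
  then show ?thesis
    using pos by (simp add: field_simps)
qed (use is_normD(2)[OF assms, of 0] in simp)

section \<open>First-order inequalities for the objective and the feasible set\<close>

text \<open>A linear functional \<open>A\<close> is represented by the vector
  \<open>adjoint A 1\<close>; uniqueness of derivatives then makes the definite description in
  \<open>gradient\<close> well defined.\<close>

lemma GDERIV_gradient:
  fixes f :: "real ^ 'n \<Rightarrow> real"
  assumes "f differentiable at x"
  shows "GDERIV f x :> gradient f x"
proof -
  obtain A where A: "(f has_derivative A) (at x)"
    using assms by (auto simp: differentiable_def)
  then interpret A: linear A
    by (rule has_derivative_linear)
  have "A h = h \<bullet> adjoint A 1" for h
    using adjoint_works[OF A.linear_axioms, of h 1] by simp
  then have "A = (\<lambda>h. h \<bullet> adjoint A 1)"
    by blast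
  then have D: "GDERIV f x :> adjoint A 1"
    using A by (simp add: gderiv_def)
  have "D' = adjoint A 1" if "GDERIV f x :> D'" for D'
  proof -
    have "(\<lambda>h. h \<bullet> D') = (\<lambda>h. h \<bullet> adjoint A 1)"
      using that D unfolding gderiv_def by (rule has_derivative_unique)
    then show ?thesis
      by (simp add: fun_eq_iff vector_eq_ldot)
  qed
  with D have "gradient f x = adjoint A 1"
    unfolding gradient_def by (rule the_equality)
  with D show ?thesis
    by simp
qed

lemma DERIV_along_segment:
  fixes f :: "real ^ 'n \<Rightarrow> real"
  assumes "f differentiable at (x + s *\<^sub>R u)"
  shows "DERIV (\<lambda>s. f (x + s *\<^sub>R u)) s :> u \<bullet> gradient f (x + s *\<^sub>R u)"
proof -
  have "(f has_derivative (\<lambda>h. h \<bullet> gradient f (x + s *\<^sub>R u))) (at (x + s *\<^sub>R u))"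
    using GDERIV_gradient[OF assms] by (simp add: gderiv_def)
  moreover have "((\<lambda>s. x + s *\<^sub>R u) has_derivative (\<lambda>h. h *\<^sub>R u)) (at s)"
    by (auto intro!: derivative_eq_intros)
  ultimately have "((\<lambda>s. f (x + s *\<^sub>R u)) has_derivative
      (\<lambda>h. (h *\<^sub>R u) \<bullet> gradient f (x + s *\<^sub>R u))) (at s)"
    by (rule has_derivative_compose[rotated])
  then show ?thesis
    by (simp add: has_field_derivative_def mult_commute_abs)
qed

text \<open>The defect \<open>\<psi>\<close> between \<open>f\<close> and its quadratic model along
  the segment has nonpositive derivative, by the duality inequality and the Lipschitz gradient.
  Monotonicity thus replaces integration of the gradient.\<close>

lemma L_smooth_on_descent:
  fixes f :: "real ^ 'n \<Rightarrow> real"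
  assumes N: "is_norm N" and C: "convex C" and f: "L_smooth_on N L C f"
    and x: "x \<in> C" and y: "y \<in> C"
  shows "f y \<le> f x + (y - x) \<bullet> gradient f x + L / 2 * (N (y - x))\<^sup>2"
proof -
  define u where "u = y - x"
  define \<psi> where "\<psi> s = f (x + s *\<^sub>R u) - s * (u \<bullet> gradient f x) - L / 2 * s\<^sup>2 * (N u)\<^sup>2" for s
  have in_C: "x + s *\<^sub>R u \<in> C" if "0 \<le> s" "s \<le> 1" for s
    using convexD_alt[OF C x y that] by (simp add: u_def algebra_simps)
  have "\<psi> 0 \<ge> \<psi> 1"
  proof (rule DERIV_nonpos_imp_nonincreasing[of 0 1 \<psi>])
    fix s :: real assume s: "0 \<le> s" "s \<le> 1"
    let ?g = "gradient f (x + s *\<^sub>R u)"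
    have "f differentiable at (x + s *\<^sub>R u)"
      using f in_C[OF s] by (auto simp: L_smooth_on_def)
    note DERIV_along_segment[OF this, derivative_intros]
    have "DERIV \<psi> s :> u \<bullet> ?g - u \<bullet> gradient f x - L * s * (N u)\<^sup>2"
      unfolding \<psi>_def by (auto intro!: derivative_eq_intros)
    moreover have "u \<bullet> ?g - u \<bullet> gradient f x \<le> L * s * (N u)\<^sup>2"
    proof -
      have "u \<bullet> (?g - gradient f x) \<le> N u * dual_norm N (?g - gradient f x)"
        by (rule inner_le_dual_norm[OF N])
      also have "\<dots> \<le> N u * (L * N ((x + s *\<^sub>R u) - x))"
        using f in_C[OF s] x is_normD(1)[OF N] unfolding L_smooth_on_def
        by (intro mult_left_mono) blast+
      also have "\<dots> = L * s * (N u)\<^sup>2"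
        using s by (simp add: is_normD(3)[OF N] power2_eq_square)
      finally show ?thesis
        by (simp add: inner_diff_right)
    qed
    ultimately show "\<exists>y. DERIV \<psi> s :> y \<and> y \<le> 0"
      by fastforce
  qed simp
  then show ?thesis
    by (simp add: \<psi>_def u_def)
qed

text \<open>If the directional derivative exceeded the slope of the chord, \<open>f\<close> would
  rise above the chord just to the right of \<open>x\<close>, against convexity.\<close>

lemma convex_on_gradient_le:
  fixes f :: "real ^ 'n \<Rightarrow> real"
  assumes f: "convex_on C f" and d: "f differentiable at x" and x: "x \<in> C" and y: "y \<in> C"
  shows "(y - x) \<bullet> gradient f x \<le> f y - f x"
proof (rule ccontr)
  define \<psi> where "\<psi> s = s * (f y - f x) - f (x + s *\<^sub>R (y - x))" for s
  assume *: "\<not> ?thesis"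
  have "f differentiable at (x + 0 *\<^sub>R (y - x))"
    using d by simp
  note DERIV_along_segment[OF this, derivative_intros]
  have "DERIV \<psi> 0 :> (f y - f x) - (y - x) \<bullet> gradient f x"
    unfolding \<psi>_def by (auto intro!: derivative_eq_intros)
  moreover have "(f y - f x) - (y - x) \<bullet> gradient f x < 0"
    using * by simp
  ultimately have "\<exists>r>0. \<forall>h>0. h < r \<longrightarrow> \<psi> (0 + h) < \<psi> 0"
    by (rule DERIV_neg_dec_right)
  then obtain r where r: "r > 0" "\<And>h. 0 < h \<Longrightarrow> h < r \<Longrightarrow> \<psi> h < \<psi> 0"
    by auto
  define s where "s = min (r / 2) 1"
  have s: "0 < s" "s < r" "s \<le> 1"
    using r(1) by (auto simp: s_def min_def)
  have "f ((1 - s) *\<^sub>R x + s *\<^sub>R y) \<le> (1 - s) * f x + s * f y"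
    using convex_onD[OF f, of s x y] s x y by simp
  moreover have "(1 - s) *\<^sub>R x + s *\<^sub>R y = x + s *\<^sub>R (y - x)"
    by (simp add: algebra_simps)
  ultimately show False
    using r(2)[OF s(1,2)] by (simp add: \<psi>_def algebra_simps)
qed

text \<open>Test optimality of \<open>v\<close> against the points of \<open>C\<close> near \<open>v\<close> and let the weight of \<open>x\<close> tend to 0.\<close>

lemma uniformly_convex_set_scaling:
  fixes N :: "real ^ 'n \<Rightarrow> real"
  assumes C: "uniformly_convex_set N \<alpha> q C" and x: "x \<in> C" and v: "v \<in> C"
    and max: "\<And>w. w \<in> C \<Longrightarrow> d \<bullet> w \<le> d \<bullet> v" and z: "N z = 1"
  shows "\<alpha> * N (x - v) powr q * (d \<bullet> z) \<le> d \<bullet> (v - x)"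
proof -
  define B where "B = \<alpha> * N (x - v) powr q * (d \<bullet> z)"
  have *: "(1 - s) * B \<le> d \<bullet> (v - x)" if s: "0 < s" "s \<le> 1" for s
  proof -
    have "s *\<^sub>R x + (1 - s) *\<^sub>R v + (s * (1 - s) * \<alpha> * N (x - v) powr q) *\<^sub>R z \<in> C"
      using C x v z s unfolding uniformly_convex_set_def by simp
    from max[OF this] have "s * ((1 - s) * B) \<le> s * (d \<bullet> (v - x))"
      by (simp add: B_def inner_add_right inner_diff_right algebra_simps)
    then show ?thesis
      using s(1) by simp
  qed
  have "((\<lambda>s. (1 - s) * B) \<longlongrightarrow> (1 - 0) * B) (at_right 0)"
    by (intro tendsto_intros)
  moreover have "\<forall>\<^sub>F s in at_right 0. (1 - s) * B \<le> d \<bullet> (v - x)"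
    using eventually_at_right_less[of 0] eventually_at_right_real[of 0 1]
    by (auto elim!: eventually_mono intro: *)
  ultimately have "(1 - 0) * B \<le> d \<bullet> (v - x)"
    by (intro tendsto_upperbound) auto
  then show ?thesis
    by (simp add: B_def)
qed

section \<open>Inequalities for real powers\<close>

text \<open>Bernoulli's inequality for exponents in [0,1]: convexity of \<open>exp\<close> between 0
  and \<open>ln x\<close>.\<close>

lemma powr_le_one_plus:
  fixes x a :: real
  assumes "0 \<le> x" "0 \<le> a" "a \<le> 1"
  shows "x powr a \<le> 1 + a * (x - 1)"
proof (cases "x = 0")
  case False
  have "exp ((1 - a) *\<^sub>R 0 + a *\<^sub>R ln x) \<le> (1 - a) * exp 0 + a * exp (ln x)"
    using assms by (intro convex_onD[OF exp_convex]) auto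
  then show ?thesis
    using False assms by (simp add: powr_def algebra_simps)
qed (use assms in simp)

text \<open>Bernoulli is applied twice: \<open>(1 + p) powr (1 / p) \<le> 2\<close> with
  \<open>p = 1 / e - 1\<close> bounds the second summand by \<open>e / 2\<close>, and at base 1/2 it
  bounds the first by \<open>1 - e / 2\<close>. It is used with
  \<open>e = 1 - \<eta>\<close>.\<close>

lemma two_powr_minus_add_le_one:
  fixes e :: real
  assumes "0 < e" "e \<le> 1 / 2"
  shows "2 powr (-e) + 2 powr (-(1 / e)) \<le> 1"
proof -
  define p where "p = 1 / e - 1"
  have p: "1 \<le> p"
    using assms by (simp add: p_def field_simps)
  have "(1 + p) powr (1 / p) \<le> 2"
    using powr_le_one_plus[of "1 + p" "1 / p"] p by simp
  then have "((1 + p) powr (1 / p)) powr p \<le> 2 powr p"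
    using p by (intro powr_mono2) auto
  moreover have "((1 + p) powr (1 / p)) powr p = 1 / e"
    using p by (simp add: powr_powr) (simp add: p_def)
  moreover have "2 powr p = 2 powr (1 / e) / 2"
    by (simp add: p_def powr_diff)
  ultimately have "2 / e \<le> 2 powr (1 / e)"
    by simp
  then have "inverse (2 powr (1 / e)) \<le> inverse (2 / e)"
    using assms(1) by (intro le_imp_inverse_le) auto
  then have "2 powr (-(1 / e)) \<le> e / 2"
    by (simp add: powr_minus)
  moreover have "2 powr (-e) \<le> 1 - e / 2"
  proof -
    have "2 powr (-e) = (1 / 2) powr e"
      by (simp add: powr_divide powr_minus_divide)
    then show ?thesis
      using powr_le_one_plus[of "1 / 2" e] assms by simp
  qed
  ultimately show ?thesis
    by simp
qed

text \<open>In terms of \<open>w\<close>, the offset is \<open>k = (1 - w) / w\<close> and halving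
  \<open>h\<close> divides \<open>h powr \<eta>\<close> by \<open>1 + w\<close>. The third bound
  makes the denominator in \<open>M\<close> positive, the fourth compares the constants in both
  regimes of the step, and the fifth serves only the first full step.\<close>

lemma two_powr_minus_one_bounds:
  fixes \<eta> :: real
  assumes "1 / 2 \<le> \<eta>" "\<eta> < 1"
  defines "w \<equiv> 2 powr \<eta> - 1"
  shows "0 < w" "w < 1" "0 < \<eta> - (1 - \<eta>) * w" "\<eta> \<le> (2 - \<eta>) * w"
    "(1 - w) powr (- ((1 - \<eta>) / \<eta>)) \<le> 2"
proof -
  have "2 powr 0 < 2 powr \<eta>" "2 powr \<eta> < 2 powr (1 :: real)"
    using assms by (intro powr_less_mono; simp)+
  then show w: "0 < w" "w < 1"
    by (simp_all add: w_def)
  have "(1 - \<eta>) * w < 1 - \<eta>"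
    using assms(1,2) w by simp
  moreover have "1 - \<eta> \<le> \<eta>"
    using assms(1) by simp
  ultimately show "0 < \<eta> - (1 - \<eta>) * w"
    by simp
  have two: "2 powr \<eta> = 2 / 2 powr (1 - \<eta>)"
    by (simp add: powr_diff)
  have "2 powr (1 - \<eta>) \<le> 2 - \<eta>"
    using powr_le_one_plus[of 2 "1 - \<eta>"] assms(1,2) by simp
  then have "(2 - \<eta>) * 2 powr \<eta> \<ge> 2"
    unfolding two by (simp add: le_divide_eq)
  then show "\<eta> \<le> (2 - \<eta>) * w"
    by (simp add: w_def algebra_simps)
  \<comment> \<open>The last claim amounts to \<open>2 powr (-(1 / p)) \<le> 1 - w\<close>, which is
    twice the preceding lemma at \<open>1 - \<eta>\<close>.\<close>
  define p where "p = (1 - \<eta>) / \<eta>"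
  have p: "0 < p"
    using assms by (simp add: p_def)
  have "2 * 2 powr (-(1 - \<eta>)) + 2 * 2 powr (-(1 / (1 - \<eta>))) \<le> 2"
    using two_powr_minus_add_le_one[of "1 - \<eta>"] assms(1,2) by simp
  moreover have "2 * 2 powr (-(1 - \<eta>)) = 2 powr \<eta>"
    by (simp add: powr_diff)
  moreover have "2 * 2 powr (-(1 / (1 - \<eta>))) = 2 powr (-(1 / p))"
  proof -
    have "-(1 / p) = 1 + - (1 / (1 - \<eta>))"
      using assms(1,2) by (simp add: p_def field_simps)
    then show ?thesis
      by (simp only: powr_add) simp
  qed
  ultimately have "2 powr (-(1 / p)) \<le> 1 - w"
    by (simp add: w_def)
  then have "(1 - w) powr (-p) \<le> (2 powr (-(1 / p))) powr (-p)"
    using p by (intro powr_mono2') auto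
  also have "\<dots> = 2"
    using p by (simp add: powr_powr)
  finally show "(1 - w) powr (- ((1 - \<eta>) / \<eta>)) \<le> 2"
    by (simp add: p_def)
qed

lemma powr_mult_one_minus_le:
  fixes h h' \<eta> z :: real
  assumes "0 < h" "0 \<le> h'" "h' \<le> h * (1 - z)" "0 \<le> \<eta>" "\<eta> \<le> 1"
  shows "h' powr \<eta> \<le> h powr \<eta> * (1 - \<eta> * z)"
proof -
  have "0 \<le> h * (1 - z)"
    using assms by linarith
  then have z: "z \<le> 1"
    using assms(1) by (simp add: zero_le_mult_iff)
  have "h' powr \<eta> \<le> (h * (1 - z)) powr \<eta>"
    using assms by (intro powr_mono2) auto
  also have "\<dots> = h powr \<eta> * (1 - z) powr \<eta>"
    using assms z by (simp add: powr_mult)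
  also have "\<dots> \<le> h powr \<eta> * (1 - \<eta> * z)"
    using powr_le_one_plus[of "1 - z" \<eta>] assms z by (intro mult_left_mono) auto
  finally show ?thesis .
qed

section \<open>The scalar recursion for the primal gap\<close>

text \<open>Since \<open>1 + k = 1 / w\<close>, the bound \<open>P * w\<close> is the invariant at
  index 1. Either \<open>h powr \<eta>\<close> shrinks by the factor \<open>1 - w\<close> and the
  initial bound suffices, or the curvature inequality yields
  \<open>c * h' powr \<eta> \<le> 1\<close> outright.\<close>

lemma full_step_rate_first:
  fixes \<eta> c h h' g S P w :: real
  assumes \<eta>: "1 / 2 \<le> \<eta>" "\<eta> < 1" and w: "w = 2 powr \<eta> - 1"
    and h: "0 < h" "0 \<le> h'" "h \<le> g" and c: "0 < c"
    and S: "S \<le> g" "h' \<le> h - g + S / 2" "c * h powr \<eta> * S \<le> g"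
    and P: "2 powr \<eta> / ((\<eta> - (1 - \<eta>) * w) * c) \<le> P" "h powr \<eta> * ((1 - w) / w) \<le> P"
  shows "h' powr \<eta> \<le> P * w"
proof (cases "h' powr \<eta> \<le> (1 - w) * h powr \<eta>")
  case True
  have "(1 - w) * h powr \<eta> \<le> P * w"
    using P(2) two_powr_minus_one_bounds(1)[OF \<eta>] by (simp add: w field_simps)
  with True show ?thesis
    by linarith
next
  case False
  note wb = two_powr_minus_one_bounds[OF \<eta>, folded w]
  have h': "0 < h'"
    using False h wb by (cases "h' = 0") auto
  define \<rho> where "\<rho> = h' / h"
  have \<rho>: "0 < \<rho>" "h' = \<rho> * h"
    using h h' by (auto simp: \<rho>_def)
  have \<rho>_powr: "1 - w < \<rho> powr \<eta>"
    using False h \<rho> by (simp add: powr_mult)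
  \<comment> \<open>Both factors are nonnegative; expanding gives
    \<open>2 * g * h' \<le> h * S\<close>, so a large remaining gap forces a large \<open>S\<close>,
    which \<open>S(3)\<close> in turn limits.\<close>
  have "0 \<le> (g - h) * (h - h')"
    using h S by (intro mult_nonneg_nonneg) linarith+
  then have "g * h' \<le> h * (h' - h + g)"
    by (simp add: algebra_simps)
  then have "c * h powr \<eta> * (2 * (g * h')) \<le> c * h powr \<eta> * (h * S)"
  proof (intro mult_left_mono)
    assume *: "g * h' \<le> h * (h' - h + g)"
    have "2 * (h' - h + g) \<le> S"
      using S(2) by (simp add: field_simps)
    then have "h * (2 * (h' - h + g)) \<le> h * S"
      using h(1) by simp
    with * show "2 * (g * h') \<le> h * S"
      by (simp add: algebra_simps)
  qed (use c in auto)
  also have "\<dots> \<le> h * g"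
    using mult_left_mono[OF S(3), of h] h(1) by (simp add: algebra_simps)
  finally have "(2 * (c * h powr \<eta>) * \<rho>) * (g * h) \<le> 1 * (g * h)"
    by (simp add: \<rho>(2) algebra_simps)
  then have 1: "2 * (c * h powr \<eta>) * \<rho> \<le> 1"
    using h by (simp del: mult_le_cancel_right1 add: mult_le_cancel_right)
  \<comment> \<open>The surplus factor \<open>\<rho> powr (\<eta> - 1)\<close> has a negative
    exponent; it stays at most 2 because \<open>\<rho> powr \<eta>\<close> exceeds
    \<open>1 - w\<close>.\<close>
  have "c * h' powr \<eta> = (c * h powr \<eta> * \<rho>) * \<rho> powr (\<eta> - 1)"
    using h \<rho> by (simp add: powr_mult powr_diff)
  also have "\<dots> \<le> 1 / 2 * \<rho> powr (\<eta> - 1)"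
    using 1 by (intro mult_right_mono) auto
  also have "\<rho> powr (\<eta> - 1) = (\<rho> powr \<eta>) powr (- ((1 - \<eta>) / \<eta>))"
    using \<eta> by (simp add: powr_powr)
  also have "\<dots> \<le> (1 - w) powr (- ((1 - \<eta>) / \<eta>))"
    using \<eta> wb \<rho>_powr by (intro powr_mono2') auto
  also have "\<dots> \<le> 2"
    by (rule wb)
  finally have "c * h' powr \<eta> \<le> 1"
    by simp
  then have "h' powr \<eta> \<le> 1 / c"
    using c by (simp add: field_simps)
  also have "\<dots> \<le> w * (2 powr \<eta> / ((\<eta> - (1 - \<eta>) * w) * c))"
  proof -
    have "\<eta> - (1 - \<eta>) * w \<le> w * 2 powr \<eta>"
    proof -
      have "\<eta> \<le> (2 - \<eta>) * w + w * w"
        using wb(4) by (rule order_trans) simp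
      then show ?thesis
        by (simp add: w algebra_simps)
    qed
    then have "1 \<le> w * 2 powr \<eta> / (\<eta> - (1 - \<eta>) * w)"
      using wb(3) by (simp only: le_divide_eq_1_pos)
    then have "1 / c \<le> w * 2 powr \<eta> / (\<eta> - (1 - \<eta>) * w) / c"
      using c by (intro divide_right_mono) auto
    then show ?thesis
      by simp
  qed
  also have "\<dots> \<le> w * P"
    using P(1) wb by (intro mult_left_mono) auto
  finally show ?thesis
    by (simp add: mult.commute)
qed

text \<open>Here \<open>c\<close> stands for \<open>Cc\<close> and \<open>S\<close> for
  \<open>L\<close> times the squared length of \<open>v - x\<close>. The model is minimised at
  \<open>g / S\<close>, so the cases are whether this point reaches 1.\<close>

lemma frank_wolfe_rate_step:
  fixes \<eta> c h h' g S P k :: real and t :: nat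
  assumes \<eta>: "1 / 2 \<le> \<eta>" "\<eta> < 1" and k: "k = (2 - 2 powr \<eta>) / (2 powr \<eta> - 1)"
    and h: "0 < h" "0 \<le> h'" "h \<le> g" and c: "0 < c" and S: "0 \<le> S" "c * h powr \<eta> * S \<le> g"
    and step: "\<And>\<gamma>. 0 \<le> \<gamma> \<Longrightarrow> \<gamma> \<le> 1 \<Longrightarrow> h' \<le> h - \<gamma> * g + \<gamma>\<^sup>2 / 2 * S"
    and P: "2 powr \<eta> / ((\<eta> - (1 - \<eta>) * (2 powr \<eta> - 1)) * c) \<le> P"
    and IH: "h powr \<eta> * (real t + k) \<le> P"
  shows "h' powr \<eta> * (real (Suc t) + k) \<le> P"
proof -
  define w where "w = 2 powr \<eta> - 1"
  note wb = two_powr_minus_one_bounds[OF \<eta>, folded w_def]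
  have k': "k = (1 - w) / w"
    by (simp add: k w_def)
  have k_pos: "0 < k"
    using wb by (simp add: k')
  define H where "H = h powr \<eta>"
  have H: "0 < H"
    using h by (simp add: H_def)
  define \<tau> where "\<tau> = real t + k"
  have \<tau>: "0 < \<tau>" "H * \<tau> \<le> P"
    using k_pos IH by (auto simp: \<tau>_def H_def)
  show ?thesis
  proof (cases "S \<le> g")
    case full: True
    have full_step: "h' \<le> h - g + S / 2"
      using step[of 1] by simp
    show ?thesis
    proof (cases "t = 0")
      case True
      have "h' powr \<eta> \<le> P * w"
        using \<eta> w_def h c full full_step S(2) P[folded w_def]
        by (rule full_step_rate_first) (use IH True in \<open>simp add: k'\<close>)
      moreover have "real (Suc t) + k = 1 / w"
        using True wb by (simp add: k' field_simps)
      ultimately show ?thesis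
        using wb by (simp only: mult_1_right times_divide_eq_right pos_divide_le_eq)
    next
      case False
      have "h' \<le> h / 2"
        using full_step full h by linarith
      then have "h' powr \<eta> \<le> (h / 2) powr \<eta>"
        using h \<eta> by (intro powr_mono2) auto
      also have "\<dots> = H / (1 + w)"
        using h by (simp add: powr_divide H_def w_def)
      finally have "h' powr \<eta> * (\<tau> + 1) \<le> H / (1 + w) * (\<tau> + 1)"
        using \<tau> by (intro mult_right_mono) auto
      \<comment> \<open>This needs \<open>t \<ge> 1\<close>: then
        \<open>w * \<tau> \<ge> w * (1 + k) = 1\<close>.\<close>
      moreover have "\<tau> + 1 \<le> (1 + w) * \<tau>"
      proof -
        have "w * (1 + k) = 1"
          using wb by (simp add: k' field_simps)
        moreover have "w * (1 + k) \<le> w * \<tau>"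
          using wb False by (intro mult_left_mono) (auto simp: \<tau>_def)
        ultimately have "1 \<le> w * \<tau>"
          by linarith
        then show ?thesis
          by (simp add: algebra_simps)
      qed
      then have "H / (1 + w) * (\<tau> + 1) \<le> H / (1 + w) * ((1 + w) * \<tau>)"
        using H wb by (intro mult_left_mono) auto
      moreover have "H / (1 + w) * ((1 + w) * \<tau>) = H * \<tau>"
        using wb by simp
      ultimately have "h' powr \<eta> * (\<tau> + 1) \<le> P"
        using \<tau>(2) by linarith
      then show ?thesis
        by (simp add: \<tau>_def algebra_simps)
    qed
  next
    case False
    then have S_pos: "0 < S"
      using h by linarith
    have "h' \<le> h - g / S * g + (g / S)\<^sup>2 / 2 * S"
      using step[of "g / S"] False h S_pos by simp
    also have "\<dots> = h - g * g / (2 * S)"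
      using S_pos by (simp add: power2_eq_square field_simps)
    also have "\<dots> \<le> h - c * H * h / 2"
    proof -
      have "(c * H * S) * h \<le> g * g"
        using S(2) h c H S_pos by (intro mult_mono) (auto simp: H_def)
      then show ?thesis
        using S_pos by (simp add: field_simps)
    qed
    finally have "h' \<le> h * (1 - c * H / 2)"
      by (simp add: algebra_simps)
    then have "h' powr \<eta> \<le> H * (1 - \<eta> * (c * H / 2))"
      unfolding H_def using h \<eta> by (intro powr_mult_one_minus_le) auto
    define e where "e = \<eta> * c / 2"
    have e: "0 < e"
      using \<eta> c by (simp add: e_def)
    have "h' powr \<eta> \<le> H * (1 - e * H)"
      using \<open>h' powr \<eta> \<le> _\<close> by (simp add: e_def mult.assoc)
    \<comment> \<open>In this form the reciprocal of \<open>H\<close> grows by at least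
      \<open>e\<close> per step, which is what decay of order \<open>1 / \<tau>\<close>
      requires.\<close>
    also have "H * (1 - e * H) \<le> H / (1 + e * H)"
    proof -
      have "(1 - e * H) * (1 + e * H) \<le> 1"
        by (simp add: algebra_simps flip: power2_eq_square)
      then have "1 - e * H \<le> 1 / (1 + e * H)"
        using e H by (simp add: pos_le_divide_eq add_pos_pos)
      then show ?thesis
        using mult_left_mono[of _ _ H] H by fastforce
    qed
    finally have "h' powr \<eta> * (\<tau> + 1) \<le> H / (1 + e * H) * (\<tau> + 1)"
      using \<tau> by (intro mult_right_mono) auto
    also have "\<dots> \<le> P"
    proof -
      define D where "D = \<eta> - (1 - \<eta>) * w"
      have D: "0 < D"
        using wb(3) by (simp add: D_def)
      \<comment> \<open>This is the fourth bound on \<open>w\<close> rearranged; it yields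
        \<open>1 \<le> e * P\<close>, so the growth \<open>e\<close> pays for the increase of
        \<open>\<tau>\<close> by one.\<close>
      have "2 * D \<le> \<eta> * 2 powr \<eta>"
      proof -
        have "2 powr \<eta> = 1 + w"
          by (simp add: w_def)
        then show ?thesis
          using wb(4) by (simp add: D_def algebra_simps)
      qed
      then have "1 \<le> e * (2 powr \<eta> / (D * c))"
        using D c by (simp add: e_def field_simps)
      also have "\<dots> \<le> e * P"
        using P e by (intro mult_left_mono) (auto simp: D_def w_def)
      finally have "1 * H \<le> e * P * H"
        using H by (intro mult_right_mono) auto
      then have "H * (\<tau> + 1) \<le> P * (1 + e * H)"
        using \<tau>(2) by (simp add: algebra_simps)
      then show ?thesis
        using e H by (simp add: pos_divide_le_eq add_pos_pos)
    qed
    finally show ?thesis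
      by (simp add: \<tau>_def algebra_simps)
  qed
qed

section \<open>Curvature and progress of one Frank-Wolfe step\<close>

text \<open>With \<open>d\<close> the negative gradient, scaling along the normalised direction
  \<open>xs - x\<close> bounds \<open>g\<close> below by \<open>\<alpha> * n powr q * h / r\<close>,
  and the error bound replaces \<open>r\<close>. The power \<open>2 / q\<close> then turns
  \<open>n powr q\<close> into the square of \<open>n\<close>.\<close>

lemma frank_wolfe_gap_lower_bound:
  fixes N :: "real ^ 'n \<Rightarrow> real"
  assumes N: "is_norm N" and C: "uniformly_convex_set N \<alpha> q C"
    and pos: "0 < \<alpha>" "2 \<le> q" "0 < \<mu>" "0 < L"
    and x: "x \<in> C" and v: "v \<in> C" and max: "\<And>w. w \<in> C \<Longrightarrow> d \<bullet> w \<le> d \<bullet> v"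
    and xs: "xs \<in> C" and h: "0 < h" "h \<le> d \<bullet> (xs - x)" "N (x - xs) \<le> \<mu> * h powr \<theta>"
  shows "(\<alpha> / \<mu>) powr (2 / q) / L * h powr (1 - 2 * \<theta> / q) * (L * (N (v - x))\<^sup>2)
           \<le> d \<bullet> (v - x)"
proof -
  define n where "n = N (v - x)"
  define g where "g = d \<bullet> (v - x)"
  define r where "r = N (xs - x)"
  define p where "p = 2 / q"
  have p: "0 < p" "p \<le> 1"
    using pos by (auto simp: p_def)
  have n: "0 \<le> n"
    using is_normD(1)[OF N] by (simp add: n_def)
  have hg: "h \<le> g"
    using h(2) max[OF xs] by (simp add: g_def inner_diff_right)
  have "xs \<noteq> x"
    using h by auto
  then have r: "0 < r"
    using is_normD(1,2)[OF N, of "xs - x"] by (simp add: r_def)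
  have r_le: "r \<le> \<mu> * h powr \<theta>"
    using h(3) is_norm_minus_commute[OF N, of xs x] by (simp add: r_def)
  have "\<alpha> * N (x - v) powr q * (d \<bullet> ((1 / r) *\<^sub>R (xs - x))) \<le> g"
    unfolding g_def using r
    by (intro uniformly_convex_set_scaling[OF C x v max]) (auto simp: is_normD(3)[OF N] r_def)
  then have "\<alpha> * n powr q * (d \<bullet> (xs - x)) / r \<le> g"
    using is_norm_minus_commute[OF N, of x v] by (simp add: n_def del: scaleR_right_diff_distrib)
  then have "\<alpha> * n powr q * (d \<bullet> (xs - x)) \<le> g * r"
    using r by (simp add: pos_divide_le_eq)
  moreover have "\<alpha> * n powr q * h \<le> \<alpha> * n powr q * (d \<bullet> (xs - x))"
    using pos h by (intro mult_left_mono) auto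
  moreover have "g * r \<le> g * (\<mu> * h powr \<theta>)"
    using r_le hg h by (intro mult_left_mono) auto
  ultimately have "\<alpha> * n powr q * h \<le> g * (\<mu> * h powr \<theta>)"
    by linarith
  then have "\<alpha> / \<mu> * n powr q \<le> g * h powr (\<theta> - 1)"
    using pos h by (simp add: powr_diff field_simps)
  then have "(\<alpha> / \<mu> * n powr q) powr p \<le> (g * h powr (\<theta> - 1)) powr p"
    using p pos by (intro powr_mono2) auto
  moreover have "(\<alpha> / \<mu> * n powr q) powr p = (\<alpha> / \<mu>) powr p * n\<^sup>2"
  proof -
    have "q * p = 2"
      using pos by (simp add: p_def)
    then have "(n powr q) powr p = n\<^sup>2"
      using n by (simp add: powr_powr)
    then show ?thesis
      by (simp only: powr_mult)
  qed
  moreover have "(g * h powr (\<theta> - 1)) powr p = g powr p * h powr (p * \<theta> - p)"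
    by (simp add: powr_mult powr_powr algebra_simps)
  ultimately have "(\<alpha> / \<mu>) powr p * n\<^sup>2 * h powr (1 - p * \<theta>)
      \<le> g powr p * h powr (p * \<theta> - p) * h powr (1 - p * \<theta>)"
    by (intro mult_right_mono) auto
  also have "\<dots> = g powr p * h powr (1 - p)"
    by (simp add: mult.assoc flip: powr_add)
  \<comment> \<open>The leftover power of \<open>h\<close> is absorbed using
    \<open>h \<le> g\<close>; its exponent is nonnegative because \<open>q \<ge> 2\<close>.\<close>
  also have "\<dots> \<le> g powr p * g powr (1 - p)"
    using p h hg by (intro mult_left_mono powr_mono2) auto
  also have "\<dots> = g"
    using h hg by (simp flip: powr_add)
  finally show ?thesis
    using pos by (simp add: n_def g_def p_def algebra_simps)
qed

text \<open>The short step minimises the model, which dominates \<open>f\<close> at the chosen step;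
  line search does no worse than \<open>f\<close> at \<open>s\<close>, where the model dominates
  \<open>f\<close> too.\<close>

lemma frank_wolfe_step_progress:
  fixes N :: "real ^ 'n \<Rightarrow> real"
  assumes N: "is_norm N" and C: "convex C" and f: "L_smooth_on N L C f"
    and fw: "frank_wolfe C f x v \<gamma>"
    and rule: "short_step N L f x v \<gamma> \<or> exact_line_search f x v \<gamma>"
    and x: "x t \<in> C" and s: "0 \<le> s" "s \<le> 1"
  shows "f (x (Suc t)) \<le> f (x t) + s * ((v t - x t) \<bullet> gradient f (x t))
           + s\<^sup>2 / 2 * L * (N (v t - x t))\<^sup>2"
proof -
  let ?y = "\<lambda>s. (1 - s) *\<^sub>R x t + s *\<^sub>R v t"
  let ?b = "\<lambda>s. s * ((v t - x t) \<bullet> gradient f (x t)) + s\<^sup>2 / 2 * L * (N (v t - x t))\<^sup>2"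
  have v: "v t \<in> C" and \<gamma>: "\<gamma> t \<in> {0..1}" and x_Suc: "x (Suc t) = ?y (\<gamma> t)"
    using fw by (auto simp: frank_wolfe_def is_arg_max_linorder)
  have descent: "f (?y s) \<le> f (x t) + ?b s" if "s \<in> {0..1}" for s
  proof -
    have "?y s - x t = s *\<^sub>R (v t - x t)"
      by (simp add: algebra_simps)
    then have eqs: "N (?y s - x t) = s * N (v t - x t)"
      "(?y s - x t) \<bullet> gradient f (x t) = s * ((v t - x t) \<bullet> gradient f (x t))"
      using that by (simp_all add: is_normD(3)[OF N])
    have "?y s \<in> C"
      using that by (intro convexD_alt[OF C x v]) auto
    from L_smooth_on_descent[OF N C f x this] show ?thesis
      unfolding eqs by (simp add: power_mult_distrib mult.commute mult.left_commute)
  qed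
  from rule show ?thesis
  proof
    assume "short_step N L f x v \<gamma>"
    then have "?b (\<gamma> t) \<le> ?b s"
      using s unfolding short_step_def is_arg_min_linorder by (elim allE[of _ t]) auto
    with descent[OF \<gamma>] show ?thesis
      by (simp add: x_Suc)
  next
    assume "exact_line_search f x v \<gamma>"
    then have "f (?y (\<gamma> t)) \<le> f (?y s)"
      using s unfolding exact_line_search_def is_arg_min_linorder by (elim allE[of _ t]) auto
    with descent[of s] s show ?thesis
      by (simp add: x_Suc)
  qed
qed

section \<open>The convergence rate\<close>

theorem theorem2p10:
  fixes N :: "real ^ 'n \<Rightarrow> real"
    and C :: "(real ^ 'n) set"
    and f :: "real ^ 'n \<Rightarrow> real"
    and x v :: "nat \<Rightarrow> real ^ 'n"
    and xs :: "real ^ 'n"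
    and \<gamma> :: "nat \<Rightarrow> real"
    and \<alpha> q L \<mu> \<theta> \<eta> Cc k h0 M :: real
  assumes "is_norm N"
    and "compact C" and "convex C"
    and "uniformly_convex_set N \<alpha> q C" and "\<alpha> > 0" and "q \<ge> 2"
    and "L_smooth_on N L C f" and "convex_on C f"
    and "is_arg_min f (\<lambda>y. y \<in> C) xs"
    and "hoelder_error_bound N \<mu> \<theta> C f xs" and "\<mu> > 0" and "0 < \<theta>" and "\<theta> \<le> 1 / 2"
    and "frank_wolfe C f x v \<gamma>"
    and "short_step N L f x v \<gamma> \<or> exact_line_search f x v \<gamma>"
    and "h0 = f (x 0) - f xs"
    and "\<eta> = 1 - 2 * \<theta> / q"
    and "Cc = (\<alpha> / \<mu>) powr (2 / q) / L"
    and "k = (2 - 2 powr \<eta>) / (2 powr \<eta> - 1)"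
    and "M = max (h0 * k powr (1 / \<eta>))
                 (2 / ((\<eta> - (1 - \<eta>) * (2 powr \<eta> - 1)) * Cc) powr (1 / \<eta>))"
  shows "(\<forall>T::nat. f (x T) - f xs \<le> M / (real T + k) powr (1 / (1 - 2 * \<theta> / q))) \<and>
         (q = 2 \<and> \<theta> = 1 / 2 \<longrightarrow> (\<lambda>T. f (x T) - f xs) \<in> O(\<lambda>T. 1 / (real T)\<^sup>2))"
proof -
  note N = assms(1)
  have C: "convex C" "uniformly_convex_set N \<alpha> q C"
    and f: "L_smooth_on N L C f" "convex_on C f"
    and fw: "frank_wolfe C f x v \<gamma>"
    by fact+
  have L: "0 < L" and diff: "\<And>y. y \<in> C \<Longrightarrow> f differentiable at y"
    using f(1) by (auto simp: L_smooth_on_def)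
  have xs: "xs \<in> C" "\<And>y. y \<in> C \<Longrightarrow> f xs \<le> f y"
    using assms(9) by (auto simp: is_arg_min_linorder)
  have v: "v t \<in> C" and v_max: "w \<in> C \<Longrightarrow> (- gradient f (x t)) \<bullet> w \<le> (- gradient f (x t)) \<bullet> v t"
    for t w
    using fw by (auto simp: frank_wolfe_def is_arg_max_linorder inner_diff_right)
  have x: "x t \<in> C" for t
  proof (induction t)
    case 0
    show ?case
      using fw by (simp add: frank_wolfe_def)
  next
    case (Suc t)
    have "x (Suc t) = (1 - \<gamma> t) *\<^sub>R x t + \<gamma> t *\<^sub>R v t" "\<gamma> t \<in> {0..1}"
      using fw by (auto simp: frank_wolfe_def)
    then show ?case
      using convexD_alt[OF C(1) Suc v] by simp
  qed
  define h where "h t = f (x t) - f xs" for t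
  have h_nonneg: "0 \<le> h t" for t
    using xs(2)[OF x] by (simp add: h_def)

  have "2 * \<theta> / q \<le> 1 / 2" "0 < 2 * \<theta> / q"
    using assms(6,12,13) by (simp_all add: field_simps)
  then have \<eta>: "1 / 2 \<le> \<eta>" "\<eta> < 1"
    using assms(17) by simp_all
  note wb = two_powr_minus_one_bounds[OF \<eta>]
  have Cc: "0 < Cc"
    using assms(5,11) L by (simp add: assms(18))
  have k: "0 < k"
    using wb(1,2) by (simp add: assms(19))
  define D where "D = (\<eta> - (1 - \<eta>) * (2 powr \<eta> - 1)) * Cc"
  have D: "0 < D"
    using wb(3) Cc by (simp add: D_def)
  have M: "h 0 * k powr (1 / \<eta>) \<le> M" "2 / D powr (1 / \<eta>) \<le> M"
    by (simp_all add: assms(16,20) h_def D_def)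
  have M_pos: "0 < M"
    using D by (intro less_le_trans[OF _ M(2)]) simp
  \<comment> \<open>Raising the target bound to the power \<open>\<eta>\<close> makes it linear in
    \<open>1 / (t + k)\<close>; the two entries of the maximum give the base case and the constant
    needed in the induction step.\<close>
  define P where "P = M powr \<eta>"
  have P0: "h 0 powr \<eta> * k \<le> P"
  proof -
    have "(h 0 * k powr (1 / \<eta>)) powr \<eta> \<le> P"
      unfolding P_def using M(1) \<eta> h_nonneg by (intro powr_mono2) auto
    then show ?thesis
      using \<eta> k by (simp add: powr_mult powr_powr)
  qed
  have P: "2 powr \<eta> / D \<le> P"
  proof -
    have "(2 / D powr (1 / \<eta>)) powr \<eta> \<le> P"
      unfolding P_def using M(2) \<eta> by (intro powr_mono2) auto
    then show ?thesis
      using \<eta> D by (simp add: powr_divide powr_powr)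
  qed

  have invariant: "h t powr \<eta> * (real t + k) \<le> P" for t
  proof (induction t)
    case 0
    show ?case
      using P0 by simp
  next
    case (Suc t)
    let ?g = "(- gradient f (x t)) \<bullet> (v t - x t)"
    let ?S = "L * (N (v t - x t))\<^sup>2"
    have step: "h (Suc t) \<le> h t - s * ?g + s\<^sup>2 / 2 * ?S" if "0 \<le> s" "s \<le> 1" for s
      using frank_wolfe_step_progress[OF N C(1) f(1) fw assms(15) x that]
      by (simp add: h_def inner_commute algebra_simps)
    show ?case
    \<comment> \<open>At a minimiser the curvature estimate has no direction to test; comparison
      with the zero step shows that the gap stays zero.\<close>
    proof (cases "h t = 0")
      case True
      then have "h (Suc t) = 0"
        using step[of 0] h_nonneg[of "Suc t"] by simp
      then show ?thesis
        by (simp add: P_def)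
    next
      case False
      then have ht: "0 < h t"
        using h_nonneg[of t] by simp
      have h_le: "h t \<le> (- gradient f (x t)) \<bullet> (xs - x t)"
        using convex_on_gradient_le[OF f(2) diff[OF x] x xs(1), of t]
        by (simp add: h_def inner_commute)
      have "N (x t - xs) \<le> \<mu> * h t powr \<theta>"
        using assms(10) x by (simp add: hoelder_error_bound_def h_def)
      then have "Cc * h t powr \<eta> * ?S \<le> ?g"
        unfolding assms(17,18) using assms(5,6,11) L ht h_le
        by (intro frank_wolfe_gap_lower_bound[OF N C(2) _ _ _ _ x v v_max xs(1)])
      moreover have "h t \<le> ?g"
        using h_le v_max[OF xs(1), of t] by (simp add: inner_diff_right)
      ultimately show ?thesis
        using L P[unfolded D_def] Suc
        by (intro frank_wolfe_rate_step[OF \<eta> assms(19) ht h_nonneg _ Cc _ _ step]) auto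
    qed
  qed

  have bound: "h T \<le> M / (real T + k) powr (1 / \<eta>)" for T
  proof -
    have "h T powr \<eta> \<le> P / (real T + k)"
      using invariant[of T] k by (simp add: pos_le_divide_eq add_nonneg_pos)
    then have "(h T powr \<eta>) powr (1 / \<eta>) \<le> (P / (real T + k)) powr (1 / \<eta>)"
      using \<eta> by (intro powr_mono2) auto
    then show ?thesis
      using \<eta> k h_nonneg[of T] M_pos by (simp add: powr_powr powr_divide P_def)
  qed
  moreover have "(\<lambda>T. f (x T) - f xs) \<in> O(\<lambda>T. 1 / (real T)\<^sup>2)" if "q = 2 \<and> \<theta> = 1 / 2"
  proof (rule bigoI)
    show "\<forall>\<^sub>F T in sequentially. norm (f (x T) - f xs) \<le> M * norm (1 / (real T)\<^sup>2)"
      using eventually_gt_at_top[of 0]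
    proof eventually_elim
      case (elim T)
      have "1 / \<eta> = 2"
        using that by (simp add: assms(17) field_simps)
      then have "h T \<le> M / (real T + k)\<^sup>2"
        using bound[of T] k by simp
      \<comment> \<open>Dropping \<open>k > 0\<close> only enlarges the bound, and
        \<open>T > 0\<close> keeps the denominator nonzero.\<close>
      also have "\<dots> \<le> M / (real T)\<^sup>2"
        using elim k M_pos by (intro divide_left_mono power_mono) auto
      finally show ?case
        using h_nonneg[of T] by (simp add: h_def)
    qed
  qed
  ultimately show ?thesis
    by (simp add: h_def assms(17))
qed

end
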